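(* Let $\Omega\subset\mathbb{R}^2$ be a bounded two-phase isotropic body with complex phase conductivities $\sigma^{(\alpha)}=\sigma_1^{(\alpha)}+i\sigma_2^{(\alpha)}$, $\alpha=1,2$, such that $\beta=\sigma_1^{(1)}\sigma_2^{(2)}-\sigma_2^{(1)}\sigma_1^{(2)}\ne0$, with (known) nonzero volume fractions $f_1,f_2$ and thresholds $c^{(1)},c^{(2)}>0$. Let $\mathbf{E}=\mathbf{E}_1+i\mathbf{E}_2$, $\mathbf{J}=\mathbf{J}_1+i\mathbf{J}_2$ be complex fields solving the quasistatic equations in $\Omega$. If the material has not experienced the onset of nonlinearities, then the region $$\{(x,y)\in\mathbb{R}^2:\ \det[\mathbf{S}^{(1)}(x,y)]\ge\tau^{(1)}\ \text{and}\ \det[\mathbf{S}^{(2)}(x,y)]\ge\tau^{(2)}\}$$ is nonempty and intersects the compatible region, where $\mathbf{S}^{(\alpha)}(x,y)$, $\tau^{(\alpha)}$ and the compatible region are defined in the context.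
   Context: Phase $\alpha$ occupies $\Omega_\alpha\subset\Omega$ with characteristic function $\chi_\alpha$ ($\chi_1+\chi_2=1$ in $\Omega$ up to measure zero), and $f_\alpha=|\Omega_\alpha|/|\Omega|$. $\langle\cdot\rangle$ is the average over $\Omega$. Subscripts $1$ and $2$ on conductivities and fields denote real and imaginary parts. The quasistatic equations are $\mathbf{J}=\sigma\mathbf{E}$, $\nabla\cdot\mathbf{J}=0$, $\mathbf{E}=-\nabla V$, with complex square-integrable fields and $\sigma=\sigma^{(1)}\chi_1+\sigma^{(2)}\chi_2$. Put $\mathbf{E}_m^{(\alpha)}=\chi_\alpha\mathbf{E}_m$. Onset of nonlinearities at a point $\mathbf{x}$ of phase $\alpha$ is the condition $|\mathbf{E}_1(\mathbf{x})|^2+|\mathbf{E}_2(\mathbf{x})|^2\ge(c^{(\alpha)})^2$; the material has not experienced it if $|\mathbf{E}_1|^2+|\mathbf{E}_2|^2<(c^{(\alpha)})^2$ (almost) everywhere in $\Omega_\alpha$, $\alpha=1,2$. Put $\mathbf{R}_\perp=\begin{bmatrix}0&1\\-1&0\end{bmatrix}$ and $$\tau^{(\alpha)}=\left[\langle\mathbf{E}_1^{(\alpha)}\cdot\mathbf{R}_\perp\mathbf{E}_2^{(\alpha)}\rangle-\frac{1}{f_\alpha}\langle\mathbf{E}_1^{(\alpha)}\rangle\cdot\mathbf{R}_\perp\langle\mathbf{E}_2^{(\alpha)}\rangle\right]^2.$$ Put $\gamma=(\sigma_1^{(1)}\sigma_1^{(2)}+\sigma_2^{(1)}\sigma_2^{(2)})/\beta$,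 $\psi^{(1)}=|\sigma^{(2)}|^2/\beta$, $\psi^{(2)}=|\sigma^{(1)}|^2/\beta$, $$\xi^{(1)}=\frac{\sigma_2^{(2)}\langle\mathbf{E}_1\cdot\mathbf{J}_2\rangle+\sigma_1^{(2)}\langle\mathbf{E}_1\cdot\mathbf{J}_1\rangle}{\beta},\qquad \xi^{(2)}=\frac{\sigma_2^{(1)}\langle\mathbf{E}_1\cdot\mathbf{J}_2\rangle+\sigma_1^{(1)}\langle\mathbf{E}_1\cdot\mathbf{J}_1\rangle}{\beta},$$ $$\eta^{(1)}=\frac{\sigma_1^{(2)}(\langle\mathbf{E}_2\cdot\mathbf{J}_1\rangle-\langle\mathbf{E}_1\cdot\mathbf{J}_2\rangle)+\sigma_2^{(2)}(\langle\mathbf{E}_1\cdot\mathbf{J}_1\rangle+\langle\mathbf{E}_2\cdot\mathbf{J}_2\rangle)}{\beta},$$ $$\eta^{(2)}=\frac{\sigma_1^{(1)}(\langle\mathbf{E}_1\cdot\mathbf{J}_2\rangle-\langle\mathbf{E}_2\cdot\mathbf{J}_1\rangle)-\sigma_2^{(1)}(\langle\mathbf{E}_1\cdot\mathbf{J}_1\rangle+\langle\mathbf{E}_2\cdot\mathbf{J}_2\rangle)}{\beta}.$$ For $(x,y)\in\mathbb{R}^2$ define the symmetric $2\times2$ matrices $\mathbf{S}^{(\alpha)}(x,y)$ with entries $S_{11}^{(1)}=x-|\langle\mathbf{E}_1^{(1)}\rangle|^2/f_1$, $S_{22}^{(1)}=-x+\eta^{(1)}-|\langle\mathbf{E}_2^{(1)}\rangle|^2/f_1$,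 $S_{21}^{(1)}=-\gamma x-\psi^{(1)}y+\xi^{(1)}-\langle\mathbf{E}_1^{(1)}\rangle\cdot\langle\mathbf{E}_2^{(1)}\rangle/f_1$; $S_{11}^{(2)}=y-|\langle\mathbf{E}_1^{(2)}\rangle|^2/f_2$, $S_{22}^{(2)}=-y+\eta^{(2)}-|\langle\mathbf{E}_2^{(2)}\rangle|^2/f_2$, $S_{21}^{(2)}=\psi^{(2)}x+\gamma y-\xi^{(2)}-\langle\mathbf{E}_1^{(2)}\rangle\cdot\langle\mathbf{E}_2^{(2)}\rangle/f_2$. Here $x$ and $y$ play the roles of $A_{11}^{(1)}$ and $A_{11}^{(2)}$, where $A_{mn}^{(\alpha)}=\langle\mathbf{E}_m^{(\alpha)}\cdot\mathbf{E}_n^{(\alpha)}\rangle$. The compatible region is the set of $(x,y)\in\mathbb{R}^2$ satisfying, for $\alpha=1,2$, $A_{11}^{(\alpha)}+A_{22}^{(\alpha)}\le f_\alpha(c^{(\alpha)})^2$, where here $A_{11}^{(1)}=x$, $A_{11}^{(2)}=y$, and $A_{22}^{(1)},A_{22}^{(2)}$ are expressed through $(x,y)$ by solving the linear system $$\begin{bmatrix}-\sigma_2^{(1)}&-\sigma_2^{(2)}&0&0\\ \sigma_1^{(1)}&\sigma_1^{(2)}&0&0\\ \sigma_1^{(1)}&\sigma_1^{(2)}&-\sigma_2^{(1)}&-\sigma_2^{(2)}\\ \sigma_2^{(1)}&\sigma_2^{(2)}&\sigma_1^{(1)}&\sigma_1^{(2)}\end{bmatrix}\begin{bmatrix} A_{21}^{(1)}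 \\ A_{21}^{(2)} \\ A_{22}^{(1)} \\ A_{22}^{(2)} \end{bmatrix}=\begin{bmatrix}\langle\mathbf{E}_1\cdot\mathbf{J}_1\rangle-\sigma_1^{(1)}x-\sigma_1^{(2)}y\\ \langle\mathbf{E}_1\cdot\mathbf{J}_2\rangle-\sigma_2^{(1)}x-\sigma_2^{(2)}y\\ \langle\mathbf{E}_2\cdot\mathbf{J}_1\rangle\\ \langle\mathbf{E}_2\cdot\mathbf{J}_2\rangle\end{bmatrix}.$$ *)

theory Defs
  imports "HOL-Analysis.Analysis"
begin

text \<open>
  Phases are indexed by the two-element type \<open>2\<close>, whose elements are \<open>1\<close> and \<open>2\<close>:
  \<open>P \<alpha>\<close> is the region of phase \<open>\<alpha>\<close>, \<open>\<sigma> \<alpha>\<close> its complex conductivity and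
  \<open>c \<alpha>\<close> its threshold. Complex fields are functions on all of \<open>real^2\<close>; only their
  values almost everywhere in the body \<open>\<Omega>\<close> matter.
\<close>

subsection \<open>Smooth test functions and weak differential operators\<close>

definition partial_deriv :: "2 \<Rightarrow> (real^2 \<Rightarrow> real) \<Rightarrow> real^2 \<Rightarrow> real" where
  "partial_deriv i \<phi> x = frechet_derivative \<phi> (at x) (axis i 1)"

primrec C_k :: "nat \<Rightarrow> (real^2 \<Rightarrow> real) \<Rightarrow> bool" where
  "C_k 0 \<phi> \<longleftrightarrow> continuous_on UNIV \<phi>"
| "C_k (Suc k) \<phi> \<longleftrightarrow> (\<forall>x. \<phi> differentiable (at x)) \<and> (\<forall>i. C_k k (partial_deriv i \<phi>))"

definition test_function :: "(real^2) set \<Rightarrow> (real^2 \<Rightarrow> real) \<Rightarrow> bool" where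
  "test_function \<Omega> \<phi> \<longleftrightarrow>
     (\<forall>k. C_k k \<phi>) \<and> compact (closure {x. \<phi> x \<noteq> 0}) \<and> closure {x. \<phi> x \<noteq> 0} \<subseteq> \<Omega>"

definition square_integrable :: "(real^2) set \<Rightarrow> (real^2 \<Rightarrow> complex^2) \<Rightarrow> bool" where
  "square_integrable \<Omega> F \<longleftrightarrow>
     F \<in> borel_measurable (lebesgue_on \<Omega>) \<and> integrable (lebesgue_on \<Omega>) (\<lambda>x. (norm (F x))\<^sup>2)"

definition locally_integrable :: "(real^2) set \<Rightarrow> (real^2 \<Rightarrow> complex) \<Rightarrow> bool" where
  "locally_integrable \<Omega> V \<longleftrightarrow> (\<forall>K. compact K \<and> K \<subseteq> \<Omega> \<longrightarrow> integrable (lebesgue_on K) V)"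

definition weak_gradient ::
    "(real^2) set \<Rightarrow> (real^2 \<Rightarrow> complex) \<Rightarrow> (real^2 \<Rightarrow> complex^2) \<Rightarrow> bool" where
  "weak_gradient \<Omega> V G \<longleftrightarrow>
     (\<forall>\<phi>. test_function \<Omega> \<phi> \<longrightarrow>
        (\<forall>i. (LINT x|lebesgue_on \<Omega>. partial_deriv i \<phi> x *\<^sub>R V x) =
             - (LINT x|lebesgue_on \<Omega>. \<phi> x *\<^sub>R (G x $ i))))"

definition weakly_divergence_free :: "(real^2) set \<Rightarrow> (real^2 \<Rightarrow> complex^2) \<Rightarrow> bool" where
  "weakly_divergence_free \<Omega> F \<longleftrightarrow>
     (\<forall>\<phi>. test_function \<Omega> \<phi> \<longrightarrow>
        (LINT x|lebesgue_on \<Omega>. (\<Sum>i\<in>UNIV. partial_deriv i \<phi> x *\<^sub>R (F x $ i))) = 0)"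

subsection \<open>Two-phase bodies and the quasistatic equations\<close>

definition two_phase_body :: "(real^2) set \<Rightarrow> (2 \<Rightarrow> (real^2) set) \<Rightarrow> bool" where
  "two_phase_body \<Omega> P \<longleftrightarrow>
     open \<Omega> \<and> bounded \<Omega> \<and> (\<forall>\<alpha>. P \<alpha> \<in> sets lebesgue \<and> P \<alpha> \<subseteq> \<Omega>) \<and>
     (AE x in lebesgue_on \<Omega>. indicat_real (P 1) x + indicat_real (P 2) x = 1)"

definition vol_frac :: "(real^2) set \<Rightarrow> (real^2) set \<Rightarrow> real" where
  "vol_frac \<Omega> Q = measure lebesgue Q / measure lebesgue \<Omega>"

definition conductivity :: "(2 \<Rightarrow> (real^2) set) \<Rightarrow> (2 \<Rightarrow> complex) \<Rightarrow> real^2 \<Rightarrow> complex" where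
  "conductivity P \<sigma> x = \<sigma> 1 * indicator (P 1) x + \<sigma> 2 * indicator (P 2) x"

definition quasistatic ::
    "(real^2) set \<Rightarrow> (real^2 \<Rightarrow> complex) \<Rightarrow> (real^2 \<Rightarrow> complex^2) \<Rightarrow> (real^2 \<Rightarrow> complex^2) \<Rightarrow> bool" where
  "quasistatic \<Omega> s E J \<longleftrightarrow>
     square_integrable \<Omega> E \<and> square_integrable \<Omega> J \<and>
     (AE x in lebesgue_on \<Omega>. J x = s x *s E x) \<and>
     weakly_divergence_free \<Omega> J \<and>
     (\<exists>V. locally_integrable \<Omega> V \<and> weak_gradient \<Omega> V (\<lambda>x. - E x))"

definition re_field :: "(real^2 \<Rightarrow> complex^2) \<Rightarrow> real^2 \<Rightarrow> real^2" where
  "re_field F x = (\<chi> i. Re (F x $ i))"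

definition im_field :: "(real^2 \<Rightarrow> complex^2) \<Rightarrow> real^2 \<Rightarrow> real^2" where
  "im_field F x = (\<chi> i. Im (F x $ i))"

definition onset_of_nonlinearity :: "real \<Rightarrow> (real^2 \<Rightarrow> complex^2) \<Rightarrow> real^2 \<Rightarrow> bool" where
  "onset_of_nonlinearity c E x \<longleftrightarrow> (norm (re_field E x))\<^sup>2 + (norm (im_field E x))\<^sup>2 \<ge> c\<^sup>2"

subsection \<open>Averages and the matrices S\<close>

definition avg :: "(real^2) set \<Rightarrow> (real^2 \<Rightarrow> 'a::{banach, second_countable_topology}) \<Rightarrow> 'a" where
  "avg \<Omega> g = (LINT x|lebesgue_on \<Omega>. g x) /\<^sub>R measure lebesgue \<Omega>"

definition avg_dot :: "(real^2) set \<Rightarrow> (real^2 \<Rightarrow> real^2) \<Rightarrow> (real^2 \<Rightarrow> real^2) \<Rightarrow> real" where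
  "avg_dot \<Omega> F G = avg \<Omega> (\<lambda>x. F x \<bullet> G x)"

definition phase_field :: "(real^2) set \<Rightarrow> (real^2 \<Rightarrow> real^2) \<Rightarrow> real^2 \<Rightarrow> real^2" where
  "phase_field Q F x = indicat_real Q x *\<^sub>R F x"

definition R_perp :: "real^2^2" where
  "R_perp = vector [vector [0, 1], vector [-1, 0]]"

definition tau :: "(real^2) set \<Rightarrow> (real^2) set \<Rightarrow> (real^2 \<Rightarrow> complex^2) \<Rightarrow> real" where
  "tau \<Omega> Q E =
     (let E1 = phase_field Q (re_field E); E2 = phase_field Q (im_field E) in
      (avg_dot \<Omega> E1 (\<lambda>x. R_perp *v E2 x)
       - 1 / vol_frac \<Omega> Q * (avg \<Omega> E1 \<bullet> (R_perp *v avg \<Omega> E2)))\<^sup>2)"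

definition beta :: "(2 \<Rightarrow> complex) \<Rightarrow> real" where
  "beta \<sigma> = Re (\<sigma> 1) * Im (\<sigma> 2) - Im (\<sigma> 1) * Re (\<sigma> 2)"

definition gamma :: "(2 \<Rightarrow> complex) \<Rightarrow> real" where
  "gamma \<sigma> = (Re (\<sigma> 1) * Re (\<sigma> 2) + Im (\<sigma> 1) * Im (\<sigma> 2)) / beta \<sigma>"

definition psi1 :: "(2 \<Rightarrow> complex) \<Rightarrow> real" where
  "psi1 \<sigma> = (cmod (\<sigma> 2))\<^sup>2 / beta \<sigma>"

definition psi2 :: "(2 \<Rightarrow> complex) \<Rightarrow> real" where
  "psi2 \<sigma> = (cmod (\<sigma> 1))\<^sup>2 / beta \<sigma>"

definition xi1 ::
    "(real^2) set \<Rightarrow> (2 \<Rightarrow> complex) \<Rightarrow> (real^2 \<Rightarrow> complex^2) \<Rightarrow> (real^2 \<Rightarrow> complex^2) \<Rightarrow> real" where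
  "xi1 \<Omega> \<sigma> E J =
     (Im (\<sigma> 2) * avg_dot \<Omega> (re_field E) (im_field J)
      + Re (\<sigma> 2) * avg_dot \<Omega> (re_field E) (re_field J)) / beta \<sigma>"

definition xi2 ::
    "(real^2) set \<Rightarrow> (2 \<Rightarrow> complex) \<Rightarrow> (real^2 \<Rightarrow> complex^2) \<Rightarrow> (real^2 \<Rightarrow> complex^2) \<Rightarrow> real" where
  "xi2 \<Omega> \<sigma> E J =
     (Im (\<sigma> 1) * avg_dot \<Omega> (re_field E) (im_field J)
      + Re (\<sigma> 1) * avg_dot \<Omega> (re_field E) (re_field J)) / beta \<sigma>"

definition eta1 ::
    "(real^2) set \<Rightarrow> (2 \<Rightarrow> complex) \<Rightarrow> (real^2 \<Rightarrow> complex^2) \<Rightarrow> (real^2 \<Rightarrow> complex^2) \<Rightarrow> real" where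
  "eta1 \<Omega> \<sigma> E J =
     (Re (\<sigma> 2) * (avg_dot \<Omega> (im_field E) (re_field J) - avg_dot \<Omega> (re_field E) (im_field J))
      + Im (\<sigma> 2) * (avg_dot \<Omega> (re_field E) (re_field J) + avg_dot \<Omega> (im_field E) (im_field J)))
     / beta \<sigma>"

definition eta2 ::
    "(real^2) set \<Rightarrow> (2 \<Rightarrow> complex) \<Rightarrow> (real^2 \<Rightarrow> complex^2) \<Rightarrow> (real^2 \<Rightarrow> complex^2) \<Rightarrow> real" where
  "eta2 \<Omega> \<sigma> E J =
     (Re (\<sigma> 1) * (avg_dot \<Omega> (re_field E) (im_field J) - avg_dot \<Omega> (im_field E) (re_field J))
      - Im (\<sigma> 1) * (avg_dot \<Omega> (re_field E) (re_field J) + avg_dot \<Omega> (im_field E) (im_field J)))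
     / beta \<sigma>"

definition sym_mat :: "real \<Rightarrow> real \<Rightarrow> real \<Rightarrow> real^2^2" where
  "sym_mat s11 s22 s21 = vector [vector [s11, s21], vector [s21, s22]]"

definition S1 ::
    "(real^2) set \<Rightarrow> (2 \<Rightarrow> (real^2) set) \<Rightarrow> (2 \<Rightarrow> complex) \<Rightarrow>
     (real^2 \<Rightarrow> complex^2) \<Rightarrow> (real^2 \<Rightarrow> complex^2) \<Rightarrow> real \<Rightarrow> real \<Rightarrow> real^2^2" where
  "S1 \<Omega> P \<sigma> E J x y =
     (let f = vol_frac \<Omega> (P 1);
          m1 = avg \<Omega> (phase_field (P 1) (re_field E));
          m2 = avg \<Omega> (phase_field (P 1) (im_field E)) in
      sym_mat
        (x - (norm m1)\<^sup>2 / f)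
        (- x + eta1 \<Omega> \<sigma> E J - (norm m2)\<^sup>2 / f)
        (- gamma \<sigma> * x - psi1 \<sigma> * y + xi1 \<Omega> \<sigma> E J - (m1 \<bullet> m2) / f))"

definition S2 ::
    "(real^2) set \<Rightarrow> (2 \<Rightarrow> (real^2) set) \<Rightarrow> (2 \<Rightarrow> complex) \<Rightarrow>
     (real^2 \<Rightarrow> complex^2) \<Rightarrow> (real^2 \<Rightarrow> complex^2) \<Rightarrow> real \<Rightarrow> real \<Rightarrow> real^2^2" where
  "S2 \<Omega> P \<sigma> E J x y =
     (let f = vol_frac \<Omega> (P 2);
          m1 = avg \<Omega> (phase_field (P 2) (re_field E));
          m2 = avg \<Omega> (phase_field (P 2) (im_field E)) in
      sym_mat
        (y - (norm m1)\<^sup>2 / f)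
        (- y + eta2 \<Omega> \<sigma> E J - (norm m2)\<^sup>2 / f)
        (psi2 \<sigma> * x + gamma \<sigma> * y - xi2 \<Omega> \<sigma> E J - (m1 \<bullet> m2) / f))"

definition det_region ::
    "(real^2) set \<Rightarrow> (2 \<Rightarrow> (real^2) set) \<Rightarrow> (2 \<Rightarrow> complex) \<Rightarrow>
     (real^2 \<Rightarrow> complex^2) \<Rightarrow> (real^2 \<Rightarrow> complex^2) \<Rightarrow> (real \<times> real) set" where
  "det_region \<Omega> P \<sigma> E J =
     {(x, y). det (S1 \<Omega> P \<sigma> E J x y) \<ge> tau \<Omega> (P 1) E \<and> det (S2 \<Omega> P \<sigma> E J x y) \<ge> tau \<Omega> (P 2) E}"

subsection \<open>The compatible region\<close>

definition system_matrix :: "(2 \<Rightarrow> complex) \<Rightarrow> real^4^4" where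
  "system_matrix \<sigma> = vector
     [vector [- Im (\<sigma> 1), - Im (\<sigma> 2), 0, 0],
      vector [Re (\<sigma> 1), Re (\<sigma> 2), 0, 0],
      vector [Re (\<sigma> 1), Re (\<sigma> 2), - Im (\<sigma> 1), - Im (\<sigma> 2)],
      vector [Im (\<sigma> 1), Im (\<sigma> 2), Re (\<sigma> 1), Re (\<sigma> 2)]]"

definition system_rhs ::
    "(real^2) set \<Rightarrow> (2 \<Rightarrow> complex) \<Rightarrow> (real^2 \<Rightarrow> complex^2) \<Rightarrow> (real^2 \<Rightarrow> complex^2) \<Rightarrow>
     real \<Rightarrow> real \<Rightarrow> real^4" where
  "system_rhs \<Omega> \<sigma> E J x y = vector
     [avg_dot \<Omega> (re_field E) (re_field J) - Re (\<sigma> 1) * x - Re (\<sigma> 2) * y,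
      avg_dot \<Omega> (re_field E) (im_field J) - Im (\<sigma> 1) * x - Im (\<sigma> 2) * y,
      avg_dot \<Omega> (im_field E) (re_field J),
      avg_dot \<Omega> (im_field E) (im_field J)]"

text \<open>
  The unknown vector is \<open>A = (A\<^sub>2\<^sub>1\<^sup>1, A\<^sub>2\<^sub>1\<^sup>2, A\<^sub>2\<^sub>2\<^sup>1, A\<^sub>2\<^sub>2\<^sup>2)\<close>, the last upper index being the
  phase. Existence of a suitable solution in \<open>compatible_region\<close> is the same as the
  condition on the solution, since the system is uniquely solvable when
  \<open>beta \<sigma> \<noteq> 0\<close> (lemma \<open>system_unique_solution\<close>).
\<close>

definition compatible_region ::
    "(real^2) set \<Rightarrow> (2 \<Rightarrow> (real^2) set) \<Rightarrow> (2 \<Rightarrow> complex) \<Rightarrow> (2 \<Rightarrow> real) \<Rightarrow>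
     (real^2 \<Rightarrow> complex^2) \<Rightarrow> (real^2 \<Rightarrow> complex^2) \<Rightarrow> (real \<times> real) set" where
  "compatible_region \<Omega> P \<sigma> c E J =
     {(x, y). \<exists>A::real^4. system_matrix \<sigma> *v A = system_rhs \<Omega> \<sigma> E J x y \<and>
        x + A $ 3 \<le> vol_frac \<Omega> (P 1) * (c 1)\<^sup>2 \<and>
        y + A $ 4 \<le> vol_frac \<Omega> (P 2) * (c 2)\<^sup>2}"

lemma vector_4:
  "(vector [a, b, c, d] :: 'a::zero^4) $ 1 = a"
  "(vector [a, b, c, d] :: 'a::zero^4) $ 2 = b"
  "(vector [a, b, c, d] :: 'a::zero^4) $ 3 = c"
  "(vector [a, b, c, d] :: 'a::zero^4) $ 4 = d"
  by (simp_all add: vector_def)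

lemma cramer_2:
  fixes a b p q x y :: real
  assumes "a * y - b * x \<noteq> 0"
  shows "a * u + x * v = p \<and> b * u + y * v = q \<longleftrightarrow>
    u = (y * p - x * q) / (a * y - b * x) \<and> v = (a * q - b * p) / (a * y - b * x)"
proof -
  let ?d = "a * y - b * x"
  have *: "a * ((y * p - x * q) / ?d) + x * ((a * q - b * p) / ?d) = p"
    "b * ((y * p - x * q) / ?d) + y * ((a * q - b * p) / ?d) = q"
    using assms by (simp_all add: divide_simps; simp add: algebra_simps)+
  have "u * ?d = y * p - x * q" "v * ?d = a * q - b * p"
    if "a * u + x * v = p" "b * u + y * v = q"
    unfolding that[symmetric] by (simp_all add: algebra_simps)
  then show ?thesis using * assms by (metis nonzero_eq_divide_eq)
qed

lemma system_unique_solution: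
  assumes "beta \<sigma> \<noteq> 0"
  shows "\<exists>!A::real^4. system_matrix \<sigma> *v A = b"
proof -
  let ?a = "Re (\<sigma> 1)" and ?b = "Im (\<sigma> 1)" and ?x = "Re (\<sigma> 2)" and ?y = "Im (\<sigma> 2)"
  let ?d = "?a * ?y - ?b * ?x"
  have d: "?d \<noteq> 0" using assms by (simp add: beta_def)
  define u where "u = (?y * b$2 - ?x * (- b$1)) / ?d"
  define v where "v = (?a * (- b$1) - ?b * b$2) / ?d"
  define p where "p = b$4 - ?b * u - ?y * v"
  define q where "q = ?a * u + ?x * v - b$3"
  define w where "w = (?y * p - ?x * q) / ?d"
  define z where "z = (?a * q - ?b * p) / ?d"
  have eq: "system_matrix \<sigma> *v A = b \<longleftrightarrow> A = vector [u, v, w, z]" for A :: "real^4"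
  proof -
    have "system_matrix \<sigma> *v A = b \<longleftrightarrow>
      (?a * A$1 + ?x * A$2 = b$2 \<and> ?b * A$1 + ?y * A$2 = - b$1) \<and>
      (?a * A$3 + ?x * A$4 = b$4 - ?b * A$1 - ?y * A$2 \<and>
       ?b * A$3 + ?y * A$4 = ?a * A$1 + ?x * A$2 - b$3)"
      by (auto simp: vec_eq_iff forall_4 system_matrix_def matrix_vector_mult_def sum_4 vector_4)
    also have "\<dots> \<longleftrightarrow> (A$1 = u \<and> A$2 = v) \<and> (A$3 = w \<and> A$4 = z)"
      unfolding cramer_2[OF d] u_def[symmetric] v_def[symmetric]
      by (auto simp: p_def q_def w_def z_def)
    also have "\<dots> \<longleftrightarrow> A = vector [u, v, w, z]"
      by (auto simp: vec_eq_iff forall_4 vector_4)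
    finally show ?thesis .
  qed
  show ?thesis unfolding eq by simp
qed

end

theory Submission
  imports Defs
begin

text \<open>
  The witness is the true pair \<open>x = \<langle>E\<^sub>1\<^sup>1 \<bullet> E\<^sub>1\<^sup>1\<rangle>\<close>, \<open>y = \<langle>E\<^sub>1\<^sup>2 \<bullet> E\<^sub>1\<^sup>2\<rangle>\<close> of second moments.
  Splitting each \<open>\<langle>E\<^sub>m \<bullet> J\<^sub>n\<rangle>\<close> into its phase contributions shows that the second moments solve
  the linear system, so \<open>S\<^sup>\<alpha>\<close> is the Gram matrix of the two real fields in phase \<open>\<alpha>\<close>
  after subtraction of their phase means. In the plane, Cauchy--Schwarz for
  \<open>L\<^sup>2\<close> fields with values in \<open>\<complex>\<close> bounds \<open>\<langle>F \<bullet> G\<rangle>\<^sup>2 + \<langle>F \<bullet> R\<^sub>\<bottom> G\<rangle>\<^sup>2\<close> by \<open>\<langle>F \<bullet> F\<rangle> \<langle>G \<bullet> G\<rangle>\<close>, which is the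
  determinant inequality; integrating the threshold inequality over a phase gives compatibility.
\<close>

section \<open>Square-integrable fields with values in a Euclidean space\<close>

definition square_int :: "'a measure \<Rightarrow> ('a \<Rightarrow> 'b::euclidean_space) \<Rightarrow> bool" where
  "square_int M F \<longleftrightarrow> F \<in> borel_measurable M \<and> integrable M (\<lambda>x. F x \<bullet> F x)"

lemma square_int_inner:
  assumes "square_int M F" "square_int M G"
  shows "integrable M (\<lambda>x. F x \<bullet> G x)"
proof (rule Bochner_Integration.integrable_bound)
  show "integrable M (\<lambda>x. F x \<bullet> F x + G x \<bullet> G x)"
    using assms by (auto simp: square_int_def)
  show "(\<lambda>x. F x \<bullet> G x) \<in> borel_measurable M"
    using assms by (auto simp: square_int_def)
  \<comment> \<open>Expanding the squared lengths of u + v and u - v gives twice this bound with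
    room to spare; the coarse form avoids a factor 1/2.\<close>
  have "\<bar>u \<bullet> v\<bar> \<le> u \<bullet> u + v \<bullet> v" for u v :: 'b
    using inner_ge_zero[of "u + v"] inner_ge_zero[of "u - v"] inner_ge_zero[of u] inner_ge_zero[of v]
    by (simp add: algebra_simps inner_commute)
  then show "AE x in M. norm (F x \<bullet> G x) \<le> norm (F x \<bullet> F x + G x \<bullet> G x)"
    by simp
qed

lemma square_int_add:
  assumes "square_int M F" "square_int M G"
  shows "square_int M (\<lambda>x. F x + G x)"
proof -
  have "integrable M (\<lambda>x. F x \<bullet> F x + 2 * (F x \<bullet> G x) + G x \<bullet> G x)"
    using square_int_inner[OF assms] assms by (auto simp: square_int_def)
  then show ?thesis
    using assms by (auto simp: square_int_def algebra_simps inner_commute)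
qed

lemma square_int_scaleR:
  assumes "square_int M F"
  shows "square_int M (\<lambda>x. a *\<^sub>R F x)"
  using assms by (auto simp: square_int_def)

lemma square_int_diff:
  assumes "square_int M F" "square_int M G"
  shows "square_int M (\<lambda>x. F x - G x)"
  using square_int_add[OF assms(1) square_int_scaleR[OF assms(2), of "-1"]] by simp

text \<open>On a finite measure space constants are integrable, so 1 + |F|^2 serves as a dominating
  function for |F|.\<close>

lemma square_int_integrable:
  assumes "square_int M F" "finite_measure M"
  shows "integrable M F"
proof (rule Bochner_Integration.integrable_bound)
  interpret finite_measure M by fact
  show "integrable M (\<lambda>x. 1 + F x \<bullet> F x)"
    using assms by (auto simp: square_int_def)
  show "F \<in> borel_measurable M"
    using assms by (auto simp: square_int_def)
  have "norm u \<le> 1 + u \<bullet> u" for u :: 'b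
  proof -
    \<comment> \<open>The sum of squares equals 2 * (1 + |u|^2 - |u|).\<close>
    have "0 \<le> (norm u - 1)\<^sup>2 + (norm u)\<^sup>2 + 1" by simp
    then show ?thesis by (simp add: power2_diff flip: power2_norm_eq_inner)
  qed
  then show "AE x in M. norm (F x) \<le> norm (1 + F x \<bullet> F x)"
    by (simp add: abs_of_nonneg)
qed

lemma square_int_indicator:
  assumes "square_int M F" "A \<in> sets M"
  shows "square_int M (\<lambda>x. indicat_real A x *\<^sub>R F x)"
proof -
  have "integrable M (\<lambda>x. indicat_real A x *\<^sub>R (F x \<bullet> F x))"
    using assms by (intro integrable_mult_indicator) (auto simp: square_int_def)
  moreover have "indicat_real A x *\<^sub>R (F x \<bullet> F x)
      = (indicat_real A x *\<^sub>R F x) \<bullet> (indicat_real A x *\<^sub>R F x)" for x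
    by (simp add: indicator_def)
  moreover have "(\<lambda>x. indicat_real A x *\<^sub>R F x) \<in> borel_measurable M"
    using assms by (auto simp: square_int_def)
  ultimately show ?thesis
    by (simp only: square_int_def simp_thms)
qed

section \<open>The quarter-turn \<open>R_perp\<close> and Cauchy-Schwarz in the plane\<close>

lemma R_perp_mult: "R_perp *v v = vector [v $ 2, - v $ 1]"
  by (simp add: R_perp_def vec_eq_iff forall_2 matrix_vector_mult_def sum_2 vector_2)

lemma R_perp_inner: "(R_perp *v u) \<bullet> (R_perp *v v) = u \<bullet> v"
  by (simp add: R_perp_mult inner_vec_def sum_2 vector_2)

lemma R_perp_inner_self: "u \<bullet> (R_perp *v u) = 0"
  by (simp add: R_perp_mult inner_vec_def sum_2 vector_2)

lemma square_int_R_perp: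
  assumes "square_int M F"
  shows "square_int M (\<lambda>x. R_perp *v F x)"
proof -
  have "(\<lambda>x. R_perp *v F x) \<in> borel_measurable M"
    using assms linear_continuous_on[OF matrix_vector_mul_bounded_linear[of R_perp]]
    by (intro borel_measurable_continuous_on[of "\<lambda>v. R_perp *v v"]) (auto simp: square_int_def)
  then show ?thesis
    using assms by (simp add: square_int_def R_perp_inner)
qed

text \<open>With the plane read as the complex numbers, the two integrands on the left are the real
  and imaginary parts of conj(F) * G, so the left side is the squared modulus of a Hermitian
  product. The proof stays real and uses a quadratic in t.\<close>

lemma planar_Cauchy_Schwarz:
  fixes F G :: "'a \<Rightarrow> real^2"
  assumes F: "square_int M F" and G: "square_int M G"
  shows "(LINT x|M. F x \<bullet> G x)\<^sup>2 + (LINT x|M. F x \<bullet> (R_perp *v G x))\<^sup>2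
    \<le> (LINT x|M. F x \<bullet> F x) * (LINT x|M. G x \<bullet> G x)"
proof -
  let ?A = "LINT x|M. F x \<bullet> F x" and ?B = "LINT x|M. G x \<bullet> G x"
  define a where "a = (LINT x|M. F x \<bullet> G x)"
  define b where "b = (LINT x|M. F x \<bullet> (R_perp *v G x))"
  define s where "s = a\<^sup>2 + b\<^sup>2"
  note RG = square_int_R_perp[OF G]
  note ints = square_int_inner[OF F F] square_int_inner[OF G G]
    square_int_inner[OF F G] square_int_inner[OF F RG]
  have quad: "0 \<le> t\<^sup>2 * ?A - 2 * t * s + s * ?B" for t
  proof -
    \<comment> \<open>G and its rotation are orthogonal and of equal length, so the bracket has
      squared length s * |G|^2, and its inner product with F integrates to a^2 + b^2 = s. In complex
      terms the bracket is (a - ib) * G.\<close>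
    let ?H = "\<lambda>x. t *\<^sub>R F x - (a *\<^sub>R G x + b *\<^sub>R (R_perp *v G x))"
    have "?H x \<bullet> ?H x = t\<^sup>2 * (F x \<bullet> F x) - 2 * t * (a * (F x \<bullet> G x) + b * (F x \<bullet> (R_perp *v G x)))
        + s * (G x \<bullet> G x)" for x
      using R_perp_inner_self[of "G x"] R_perp_inner[of "G x" "G x"]
      by (simp add: s_def inner_diff inner_add power2_eq_square inner_commute algebra_simps)
    moreover have "0 \<le> (LINT x|M. ?H x \<bullet> ?H x)"
      by (intro integral_nonneg_AE) simp
    ultimately have "0 \<le> (LINT x|M. t\<^sup>2 * (F x \<bullet> F x)
        - 2 * t * (a * (F x \<bullet> G x) + b * (F x \<bullet> (R_perp *v G x))) + s * (G x \<bullet> G x))"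
      by simp
    also have "\<dots> = t\<^sup>2 * ?A - 2 * t * (a * a + b * b) + s * ?B"
      using ints by (simp add: a_def b_def)
    finally show ?thesis by (simp add: s_def power2_eq_square)
  qed
  have A0: "0 \<le> ?A" and B0: "0 \<le> ?B" and s0: "0 \<le> s"
    by (auto intro!: integral_nonneg_AE simp: s_def)
  have "s \<le> ?A * ?B"
  proof (cases "s = 0")
    case True
    then show ?thesis using A0 B0 by simp
  next
    case False
    then have "0 < s" using s0 by simp
    \<comment> \<open>At t = \<open>?B\<close> the quadratic factors as
      \<open>?B * (?A * ?B - s)\<close>; it remains to cancel \<open>?B\<close>.\<close>
    from quad[of ?B] have "0 \<le> ?B * (?A * ?B - s)"
      by (simp add: power2_eq_square algebra_simps)
    moreover have "?B \<noteq> 0"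
    proof
      assume B: "?B = 0"
      \<comment> \<open>If \<open>?B\<close> vanished, the quadratic would be t * (t *
        \<open>?A\<close> - 2 * s), which is negative for small t > 0. This t makes t *
        \<open>?A\<close> at most s, and the 1 in the denominator covers the case
        \<open>?A = 0\<close>.\<close>
      define t where "t = s / (?A + 1)"
      have A1: "0 < ?A + 1" using A0 by linarith
      then have "0 < t" using \<open>0 < s\<close> by (simp add: t_def)
      have "0 \<le> t * (t * ?A - 2 * s)"
        using quad[of t] B by (simp add: power2_eq_square algebra_simps)
      then have "2 * s \<le> t * ?A"
        using \<open>0 < t\<close> by (simp add: zero_le_mult_iff)
      also have "\<dots> \<le> s"
        using A1 \<open>0 < s\<close> by (simp add: t_def field_simps)
      finally show False using \<open>0 < s\<close> by simp
    qed
    ultimately show ?thesis using B0 by (simp add: zero_le_mult_iff)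
  qed
  then show ?thesis by (simp add: s_def a_def b_def)
qed

section \<open>Covariances over a phase and the determinant inequality\<close>

lemma covariance_indicator:
  fixes F G :: "'a \<Rightarrow> 'b::euclidean_space"
  assumes fin: "finite_measure M" and Q: "Q \<in> sets M" "measure M Q \<noteq> 0"
    and F: "square_int M F" "\<And>x. x \<notin> Q \<Longrightarrow> F x = 0"
    and G: "square_int M G" "\<And>x. x \<notin> Q \<Longrightarrow> G x = 0"
    and u: "u = (LINT x|M. F x) /\<^sub>R measure M Q" and v: "v = (LINT x|M. G x) /\<^sub>R measure M Q"
  shows "(LINT x|M. (F x - indicat_real Q x *\<^sub>R u) \<bullet> (G x - indicat_real Q x *\<^sub>R v))
    = (LINT x|M. F x \<bullet> G x) - ((LINT x|M. F x) \<bullet> (LINT x|M. G x)) / measure M Q"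
proof -
  interpret finite_measure M by fact
  have iF: "integrable M F" and iG: "integrable M G"
    using F G fin by (auto intro: square_int_integrable)
  \<comment> \<open>The cross terms can be written without the indicator because F and G vanish off
    Q; they then integrate over the whole space.\<close>
  have "(F x - indicat_real Q x *\<^sub>R u) \<bullet> (G x - indicat_real Q x *\<^sub>R v)
      = F x \<bullet> G x - F x \<bullet> v - u \<bullet> G x + indicat_real Q x * (u \<bullet> v)" for x
    using F(2)[of x] G(2)[of x] by (cases "x \<in> Q") (auto simp: algebra_simps)
  then have "(LINT x|M. (F x - indicat_real Q x *\<^sub>R u) \<bullet> (G x - indicat_real Q x *\<^sub>R v))
      = (LINT x|M. F x \<bullet> G x) - (LINT x|M. F x) \<bullet> v - u \<bullet> (LINT x|M. G x) + measure M Q * (u \<bullet> v)"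
    using iF iG square_int_inner[OF F(1) G(1)] Q by (simp add: less_top[symmetric])
  \<comment> \<open>Since u and v are the means over Q, both cross terms and the constant term equal
    the same number; with signs -, -, + one copy is left to subtract.\<close>
  moreover have "(LINT x|M. F x) \<bullet> v = ((LINT x|M. F x) \<bullet> (LINT x|M. G x)) / measure M Q"
    "u \<bullet> (LINT x|M. G x) = ((LINT x|M. F x) \<bullet> (LINT x|M. G x)) / measure M Q"
    "measure M Q * (u \<bullet> v) = ((LINT x|M. F x) \<bullet> (LINT x|M. G x)) / measure M Q"
    using Q(2) by (simp_all add: u v divide_inverse_commute)
  ultimately show ?thesis by linarith
qed

text \<open>This is \<open>planar_Cauchy_Schwarz\<close> for the fields centred at their means over
  Q. Centring only on Q keeps them supported there, so each of the four integrals becomes a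
  covariance.\<close>

lemma planar_covariance_ineq:
  fixes F G :: "'a \<Rightarrow> real^2"
  assumes fin: "finite_measure M" and Q: "Q \<in> sets M" "measure M Q \<noteq> 0"
    and F: "square_int M F" "\<And>x. x \<notin> Q \<Longrightarrow> F x = 0"
    and G: "square_int M G" "\<And>x. x \<notin> Q \<Longrightarrow> G x = 0"
  defines "h \<equiv> measure M Q" and "m \<equiv> LINT x|M. F x" and "n \<equiv> LINT x|M. G x"
  shows "((LINT x|M. F x \<bullet> G x) - (m \<bullet> n) / h)\<^sup>2
      + ((LINT x|M. F x \<bullet> (R_perp *v G x)) - (m \<bullet> (R_perp *v n)) / h)\<^sup>2
    \<le> ((LINT x|M. F x \<bullet> F x) - (m \<bullet> m) / h) * ((LINT x|M. G x \<bullet> G x) - (n \<bullet> n) / h)"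
proof -
  interpret finite_measure M by fact
  let ?F = "\<lambda>x. F x - indicat_real Q x *\<^sub>R (m /\<^sub>R h)" and ?G = "\<lambda>x. G x - indicat_real Q x *\<^sub>R (n /\<^sub>R h)"
  have const: "square_int M (\<lambda>x. indicat_real Q x *\<^sub>R k)" for k :: "real^2"
    using Q by (intro square_int_indicator) (auto simp: square_int_def)
  have sF: "square_int M ?F" and sG: "square_int M ?G"
    by (rule square_int_diff[OF F(1) const], rule square_int_diff[OF G(1) const])
  have n': "(LINT x|M. R_perp *v G x) = R_perp *v n"
    unfolding n_def
    \<comment> \<open>By linearity \<open>R_perp\<close> commutes with integration, so rotating the
      centred G is the same as centring the rotated G, and the rotated integral is again a
      covariance.\<close>
    by (intro integral_bounded_linear matrix_vector_mul_bounded_linear square_int_integrable[OF G(1) fin])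
  have RG: "R_perp *v ?G x = R_perp *v G x - indicat_real Q x *\<^sub>R ((R_perp *v n) /\<^sub>R h)" for x
    by (simp add: matrix_vector_mult_diff_distrib matrix_vector_mult_scaleR)
  have RG0: "R_perp *v G x = 0" if "x \<notin> Q" for x
    using G(2)[OF that] by simp
  note cov = covariance_indicator[OF fin Q]
  have "(LINT x|M. ?F x \<bullet> ?G x) = (LINT x|M. F x \<bullet> G x) - (m \<bullet> n) / h"
    unfolding m_def n_def h_def by (rule cov[OF F G refl refl])
  moreover have "(LINT x|M. ?F x \<bullet> ?F x) = (LINT x|M. F x \<bullet> F x) - (m \<bullet> m) / h"
    unfolding m_def n_def h_def by (rule cov[OF F F refl refl])
  moreover have "(LINT x|M. ?G x \<bullet> ?G x) = (LINT x|M. G x \<bullet> G x) - (n \<bullet> n) / h"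
    unfolding m_def n_def h_def by (rule cov[OF G G refl refl])
  moreover have "(LINT x|M. ?F x \<bullet> (R_perp *v ?G x))
      = (LINT x|M. F x \<bullet> (R_perp *v G x)) - (m \<bullet> (R_perp *v n)) / h"
    unfolding RG unfolding n'[symmetric] unfolding m_def h_def
    by (rule cov[OF F square_int_R_perp[OF G(1)] RG0 refl refl])
  ultimately show ?thesis
    using planar_Cauchy_Schwarz[OF sF sG] by simp
qed

text \<open>Every bracket is a covariance integral divided by the area of \<Omega>, because a volume
  fraction times that area is the area of Q. All terms of the inequality are quadratic in such
  brackets, so it is \<open>planar_covariance_ineq\<close> divided by the squared area.\<close>

lemma phase_det_ineq:
  assumes L: "\<Omega> \<in> lmeasurable" "Q \<in> sets lebesgue" "Q \<subseteq> \<Omega>" and f: "vol_frac \<Omega> Q \<noteq> 0"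
    and E: "square_int (lebesgue_on \<Omega>) (re_field E)" "square_int (lebesgue_on \<Omega>) (im_field E)"
  defines "E1 \<equiv> phase_field Q (re_field E)" and "E2 \<equiv> phase_field Q (im_field E)"
  shows "tau \<Omega> Q E \<le>
    (avg_dot \<Omega> E1 E1 - (norm (avg \<Omega> E1))\<^sup>2 / vol_frac \<Omega> Q)
     * (avg_dot \<Omega> E2 E2 - (norm (avg \<Omega> E2))\<^sup>2 / vol_frac \<Omega> Q)
    - (avg_dot \<Omega> E1 E2 - (avg \<Omega> E1 \<bullet> avg \<Omega> E2) / vol_frac \<Omega> Q)\<^sup>2"
proof -
  let ?M = "lebesgue_on \<Omega>" and ?w = "measure lebesgue \<Omega>" and ?h = "measure lebesgue Q"
  \<comment> \<open>Division by zero gives 0, so a nonzero volume fraction excludes both a null body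
    and a null phase.\<close>
  have w: "?w \<noteq> 0" and h: "?h \<noteq> 0" using f by (auto simp: vol_frac_def)
  have fin: "finite_measure ?M"
    using L(1) by (simp add: finite_measure_lebesgue_on)
  have Q: "Q \<in> sets ?M" and mQ: "measure ?M Q = ?h"
    using L by (auto simp: sets_restrict_space_iff measure_restrict_space fmeasurableD)
  have s: "square_int ?M E1" "square_int ?M E2"
    unfolding E1_def E2_def phase_field_def by (auto intro!: square_int_indicator E Q)
  have z: "E1 x = 0" "E2 x = 0" if "x \<notin> Q" for x
    using that by (auto simp: E1_def E2_def phase_field_def)
  note ineq = planar_covariance_ineq[OF fin Q _ s(1) z(1) s(2) z(2), unfolded mQ, OF h]
  have dot: "avg_dot \<Omega> X Y - (avg \<Omega> X \<bullet> avg \<Omega> Y) / vol_frac \<Omega> Q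
      = ((LINT x|?M. X x \<bullet> Y x) - ((LINT x|?M. X x) \<bullet> (LINT x|?M. Y x)) / ?h) / ?w" for X Y
    using w h by (simp add: avg_dot_def avg_def vol_frac_def field_simps)
  have rot: "avg_dot \<Omega> E1 (\<lambda>x. R_perp *v E2 x)
        - 1 / vol_frac \<Omega> Q * (avg \<Omega> E1 \<bullet> (R_perp *v avg \<Omega> E2))
      = ((LINT x|?M. E1 x \<bullet> (R_perp *v E2 x))
        - ((LINT x|?M. E1 x) \<bullet> (R_perp *v (LINT x|?M. E2 x))) / ?h) / ?w"
    using w h by (simp add: avg_dot_def avg_def vol_frac_def matrix_vector_mult_scaleR field_simps)
  have w2: "0 < ?w\<^sup>2" using w by simp
  show ?thesis
    unfolding tau_def Let_def E1_def[symmetric] E2_def[symmetric] rot power2_norm_eq_inner dot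
    using divide_right_mono[OF ineq less_imp_le[OF w2]]
    by (simp add: power_divide add_divide_distrib power2_eq_square)
qed

section \<open>Moments of the complex fields: phase splitting and the threshold bound\<close>

lemma inner_re_field_im_field:
  "F x \<bullet> F x = re_field F x \<bullet> re_field F x + im_field F x \<bullet> im_field F x"
  by (simp add: re_field_def im_field_def inner_vec_def inner_complex_def sum_2)

lemma square_integrable_parts:
  assumes "square_integrable \<Omega> F"
  shows "square_int (lebesgue_on \<Omega>) (re_field F)" "square_int (lebesgue_on \<Omega>) (im_field F)"
proof -
  have F: "F \<in> borel_measurable (lebesgue_on \<Omega>)"
    and i: "integrable (lebesgue_on \<Omega>) (\<lambda>x. F x \<bullet> F x)"
    using assms by (auto simp: square_integrable_def power2_norm_eq_inner)
  have "continuous_on UNIV (\<lambda>v::complex^2. \<chi> i. Re (v $ i))"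
    "continuous_on UNIV (\<lambda>v::complex^2. \<chi> i. Im (v $ i))"
    by (intro continuous_intros)+
  from this[THEN borel_measurable_continuous_on, OF F]
  have m: "re_field F \<in> borel_measurable (lebesgue_on \<Omega>)" "im_field F \<in> borel_measurable (lebesgue_on \<Omega>)"
    by (auto simp: re_field_def[abs_def] im_field_def[abs_def])
  have "integrable (lebesgue_on \<Omega>) (\<lambda>x. re_field F x \<bullet> re_field F x)"
    by (rule Bochner_Integration.integrable_bound[OF i]) (use m in \<open>auto simp: inner_re_field_im_field\<close>)
  moreover have "integrable (lebesgue_on \<Omega>) (\<lambda>x. im_field F x \<bullet> im_field F x)"
    by (rule Bochner_Integration.integrable_bound[OF i]) (use m in \<open>auto simp: inner_re_field_im_field\<close>)
  ultimately show "square_int (lebesgue_on \<Omega>) (re_field F)" "square_int (lebesgue_on \<Omega>) (im_field F)"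
    using m by (auto simp: square_int_def)
qed

text \<open>The field D is left free so that the real and the imaginary part of E can both be
  inserted, which yields all four rows of the linear system.\<close>

lemma avg_dot_current:
  assumes body: "two_phase_body \<Omega> P"
    and D: "square_int (lebesgue_on \<Omega>) D"
    and E: "square_integrable \<Omega> E" and J: "square_integrable \<Omega> J"
    and JE: "AE x in lebesgue_on \<Omega>. J x = conductivity P \<sigma> x *s E x"
  defines "A \<equiv> \<lambda>\<alpha> F G. avg_dot \<Omega> (phase_field (P \<alpha>) F) (phase_field (P \<alpha>) G)"
  shows "avg_dot \<Omega> D (re_field J) = (\<Sum>\<alpha>\<in>UNIV.
      Re (\<sigma> \<alpha>) * A \<alpha> D (re_field E) - Im (\<sigma> \<alpha>) * A \<alpha> D (im_field E))"
    and "avg_dot \<Omega> D (im_field J) = (\<Sum>\<alpha>\<in>UNIV.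
      Im (\<sigma> \<alpha>) * A \<alpha> D (re_field E) + Re (\<sigma> \<alpha>) * A \<alpha> D (im_field E))"
proof -
  let ?M = "lebesgue_on \<Omega>"
  have "open \<Omega>" using body by (simp add: two_phase_body_def)
  then have P: "P \<alpha> \<in> sets ?M" for \<alpha>
    using body by (simp add: two_phase_body_def sets_restrict_space_iff)
  let ?d = "\<lambda>\<alpha> F x. phase_field (P \<alpha>) D x \<bullet> phase_field (P \<alpha>) F x"
  note E' = square_integrable_parts[OF E] and J' = square_integrable_parts[OF J]
  have int: "integrable ?M (?d \<alpha> F)" if "square_int ?M F" for \<alpha> F
    unfolding phase_field_def using that D P by (intro square_int_inner square_int_indicator)
  have ae: "AE x in ?M. indicat_real (P 1) x + indicat_real (P 2) x = 1"
    using body by (simp add: two_phase_body_def)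
  note meas = square_int_inner[THEN borel_measurable_integrable]
  \<comment> \<open>Indicators summing to 1 mean that exactly one phase contains x; hence placing
    the indicator on both factors of \<open>?d\<close> changes nothing. The signs are those of the
    complex product \<open>\<sigma> \<alpha>\<close> times E.\<close>
  have re: "AE x in ?M. D x \<bullet> re_field J x = (\<Sum>\<alpha>\<in>UNIV.
      Re (\<sigma> \<alpha>) * ?d \<alpha> (re_field E) x - Im (\<sigma> \<alpha>) * ?d \<alpha> (im_field E) x)"
    using JE ae
    by eventually_elim
      (auto simp: conductivity_def re_field_def im_field_def phase_field_def indicator_def
         inner_vec_def sum_2 algebra_simps split: if_splits)
  have im: "AE x in ?M. D x \<bullet> im_field J x = (\<Sum>\<alpha>\<in>UNIV.
      Im (\<sigma> \<alpha>) * ?d \<alpha> (re_field E) x + Re (\<sigma> \<alpha>) * ?d \<alpha> (im_field E) x)"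
    using JE ae
    by eventually_elim
      (auto simp: conductivity_def re_field_def im_field_def phase_field_def indicator_def
         inner_vec_def sum_2 algebra_simps split: if_splits)
  have "(LINT x|?M. D x \<bullet> re_field J x) = (LINT x|?M. (\<Sum>\<alpha>\<in>UNIV.
      Re (\<sigma> \<alpha>) * ?d \<alpha> (re_field E) x - Im (\<sigma> \<alpha>) * ?d \<alpha> (im_field E) x))"
    by (intro integral_cong_AE re meas D J' borel_measurable_sum borel_measurable_diff
        borel_measurable_times borel_measurable_const borel_measurable_integrable int E')
  also have "\<dots> = (\<Sum>\<alpha>\<in>UNIV.
      Re (\<sigma> \<alpha>) * (LINT x|?M. ?d \<alpha> (re_field E) x) - Im (\<sigma> \<alpha>) * (LINT x|?M. ?d \<alpha> (im_field E) x))"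
    using int[OF E'(1)] int[OF E'(2)] by simp
  finally have *: "(LINT x|?M. D x \<bullet> re_field J x) = \<dots>" .
  show "avg_dot \<Omega> D (re_field J) = (\<Sum>\<alpha>\<in>UNIV.
      Re (\<sigma> \<alpha>) * A \<alpha> D (re_field E) - Im (\<sigma> \<alpha>) * A \<alpha> D (im_field E))"
    by (simp add: A_def avg_dot_def avg_def * sum_2 algebra_simps)
  have "(LINT x|?M. D x \<bullet> im_field J x) = (LINT x|?M. (\<Sum>\<alpha>\<in>UNIV.
      Im (\<sigma> \<alpha>) * ?d \<alpha> (re_field E) x + Re (\<sigma> \<alpha>) * ?d \<alpha> (im_field E) x))"
    by (intro integral_cong_AE im meas D J' borel_measurable_sum borel_measurable_add
        borel_measurable_times borel_measurable_const borel_measurable_integrable int E')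
  also have "\<dots> = (\<Sum>\<alpha>\<in>UNIV.
      Im (\<sigma> \<alpha>) * (LINT x|?M. ?d \<alpha> (re_field E) x) + Re (\<sigma> \<alpha>) * (LINT x|?M. ?d \<alpha> (im_field E) x))"
    using int[OF E'(1)] int[OF E'(2)] by simp
  finally have *: "(LINT x|?M. D x \<bullet> im_field J x) = \<dots>" .
  show "avg_dot \<Omega> D (im_field J) = (\<Sum>\<alpha>\<in>UNIV.
      Im (\<sigma> \<alpha>) * A \<alpha> D (re_field E) + Re (\<sigma> \<alpha>) * A \<alpha> D (im_field E))"
    by (simp add: A_def avg_dot_def avg_def * sum_2 algebra_simps)
qed

lemma avg_dot_commute: "avg_dot \<Omega> F G = avg_dot \<Omega> G F"
  by (simp add: avg_dot_def inner_commute)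

lemma phase_energy_le_threshold:
  assumes L: "\<Omega> \<in> lmeasurable" "Q \<in> sets lebesgue" "Q \<subseteq> \<Omega>"
    and E: "square_int (lebesgue_on \<Omega>) (re_field E)" "square_int (lebesgue_on \<Omega>) (im_field E)"
    and on: "AE x in lebesgue_on Q. \<not> onset_of_nonlinearity c E x"
  defines "E1 \<equiv> phase_field Q (re_field E)" and "E2 \<equiv> phase_field Q (im_field E)"
  shows "avg_dot \<Omega> E1 E1 + avg_dot \<Omega> E2 E2 \<le> vol_frac \<Omega> Q * c\<^sup>2"
proof -
  let ?M = "lebesgue_on \<Omega>"
  interpret finite_measure ?M
    using L(1) by (simp add: finite_measure_lebesgue_on)
  have Q: "Q \<in> sets ?M" and mQ: "measure ?M Q = measure lebesgue Q"
    using L by (auto simp: sets_restrict_space_iff measure_restrict_space fmeasurableD)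
  have s: "square_int ?M E1" "square_int ?M E2"
    unfolding E1_def E2_def phase_field_def by (auto intro!: square_int_indicator E Q)
  \<comment> \<open>The null set passes from Q to \<Omega> through the full Lebesgue measure, with
    membership in Q kept as a premise.\<close>
  have "AE x in lebesgue. x \<in> Q \<longrightarrow> \<not> onset_of_nonlinearity c E x"
    using on L(2) by (simp add: AE_restrict_space_iff)
  then have "AE x in ?M. x \<in> Q \<longrightarrow> \<not> onset_of_nonlinearity c E x"
    using L(1) by (subst AE_restrict_space_iff) (auto simp: fmeasurableD elim: eventually_mono)
  \<comment> \<open>Off Q both sides vanish, which is why the strict threshold inequality becomes a
    weak one here.\<close>
  then have ae: "AE x in ?M. E1 x \<bullet> E1 x + E2 x \<bullet> E2 x \<le> indicat_real Q x * c\<^sup>2"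
    by eventually_elim
      (auto simp: E1_def E2_def phase_field_def indicator_def onset_of_nonlinearity_def power2_norm_eq_inner)
  note ints = square_int_inner[OF s(1) s(1)] square_int_inner[OF s(2) s(2)]
  have iQ: "integrable ?M (\<lambda>x. indicat_real Q x * c\<^sup>2)"
    using Q by (simp add: less_top[symmetric])
  have "(LINT x|?M. E1 x \<bullet> E1 x) + (LINT x|?M. E2 x \<bullet> E2 x) = (LINT x|?M. E1 x \<bullet> E1 x + E2 x \<bullet> E2 x)"
    using ints by simp
  also have "\<dots> \<le> (LINT x|?M. indicat_real Q x * c\<^sup>2)"
    using ints iQ ae by (intro integral_mono_AE) auto
  also have "\<dots> = measure lebesgue Q * c\<^sup>2"
    using Q mQ L(3) by (simp add: Int_absorb2)
  finally show ?thesis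
    using divide_right_mono[of _ _ "measure lebesgue \<Omega>"]
    by (fastforce simp: avg_dot_def avg_def vol_frac_def field_simps simp flip: add_divide_distrib)
qed

section \<open>The true second moments as the common point of both regions\<close>

theorem theorem4p2:
  fixes \<Omega> :: "(real^2) set"
    and P :: "2 \<Rightarrow> (real^2) set"
    and \<sigma> :: "2 \<Rightarrow> complex"
    and c :: "2 \<Rightarrow> real"
    and E J :: "real^2 \<Rightarrow> complex^2"
  assumes "two_phase_body \<Omega> P"
    and "beta \<sigma> \<noteq> 0"
    and "\<And>\<alpha>. vol_frac \<Omega> (P \<alpha>) \<noteq> 0"
    and "\<And>\<alpha>. c \<alpha> > 0"
    and "quasistatic \<Omega> (conductivity P \<sigma>) E J"
    and "\<And>\<alpha>. AE x in lebesgue_on (P \<alpha>). \<not> onset_of_nonlinearity (c \<alpha>) E x"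
  shows "det_region \<Omega> P \<sigma> E J \<noteq> {} \<and>
         det_region \<Omega> P \<sigma> E J \<inter> compatible_region \<Omega> P \<sigma> c E J \<noteq> {}"
proof -
  have L: "\<Omega> \<in> lmeasurable"
    using assms(1) by (simp add: two_phase_body_def lmeasurable_open)
  have P: "P \<alpha> \<in> sets lebesgue" "P \<alpha> \<subseteq> \<Omega>" for \<alpha>
    using assms(1) by (auto simp: two_phase_body_def)
  have E: "square_integrable \<Omega> E" and J: "square_integrable \<Omega> J"
    and JE: "AE x in lebesgue_on \<Omega>. J x = conductivity P \<sigma> x *s E x"
    using assms(5) by (auto simp: quasistatic_def)
  note E' = square_integrable_parts[OF E]
  define A11 where "A11 \<alpha> = avg_dot \<Omega> (phase_field (P \<alpha>) (re_field E)) (phase_field (P \<alpha>) (re_field E))" for \<alpha>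
  define A21 where "A21 \<alpha> = avg_dot \<Omega> (phase_field (P \<alpha>) (re_field E)) (phase_field (P \<alpha>) (im_field E))" for \<alpha>
  define A22 where "A22 \<alpha> = avg_dot \<Omega> (phase_field (P \<alpha>) (im_field E)) (phase_field (P \<alpha>) (im_field E))" for \<alpha>
  \<comment> \<open>The commuted instance turns the mixed moment of imaginary with real part into
    \<open>A21\<close>, so the current identities involve only these three families.\<close>
  note A = A11_def[symmetric] A21_def[symmetric] A22_def[symmetric]
    avg_dot_commute[of \<Omega> "phase_field _ (im_field E)" "phase_field _ (re_field E)"]
  note cur1 = avg_dot_current[OF assms(1) E'(1) E J JE, unfolded A sum_2]
  note cur2 = avg_dot_current[OF assms(1) E'(2) E J JE, unfolded A sum_2]
  let ?x = "A11 1" and ?y = "A11 2"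
  have b: "beta \<sigma> \<noteq> 0" by fact
  \<comment> \<open>In \<langle>E2 . J1\<rangle> - \<langle>E1 . J2\<rangle> and in \<langle>E1 .
    J1\<rangle> + \<langle>E2 . J2\<rangle> the \<open>A21\<close> terms cancel. Weighting by the
    conductivity of one phase, as in Cramer's rule, removes that phase and leaves
    \<open>beta\<close> times \<open>A11 + A22\<close> of the other. The \<open>xi\<close>
    combinations likewise isolate \<open>A21\<close> of one phase, with the \<open>A11\<close> terms
    absorbed by \<open>gamma\<close>, \<open>psi1\<close> and \<open>psi2\<close>.\<close>
  have eta1: "- ?x + eta1 \<Omega> \<sigma> E J = A22 1" and eta2: "- ?y + eta2 \<Omega> \<sigma> E J = A22 2"
    and xi1: "- gamma \<sigma> * ?x - psi1 \<sigma> * ?y + xi1 \<Omega> \<sigma> E J = A21 1"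
    and xi2: "psi2 \<sigma> * ?x + gamma \<sigma> * ?y - xi2 \<Omega> \<sigma> E J = A21 2"
    unfolding eta1_def eta2_def xi1_def xi2_def gamma_def psi1_def psi2_def cur1 cur2 cmod_power2
    using b by (simp_all add: field_simps; simp add: beta_def power2_eq_square algebra_simps)+
  note det = phase_det_ineq[OF L P assms(3) E', unfolded A]
  have "(?x, ?y) \<in> det_region \<Omega> P \<sigma> E J"
    unfolding det_region_def mem_Collect_eq prod.case S1_def S2_def Let_def eta1 eta2 xi1 xi2
    using det[of 1] det[of 2]
    by (simp add: sym_mat_def det_2 vector_2 flip: power2_eq_square)
  moreover have "(?x, ?y) \<in> compatible_region \<Omega> P \<sigma> c E J"
  proof -
    let ?A = "vector [A21 1, A21 2, A22 1, A22 2] :: real^4"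
    \<comment> \<open>The rows are the identities \<open>cur1\<close> and \<open>cur2\<close>, with
      the \<open>A11\<close> terms of the first two moved to the right-hand side.\<close>
    have "system_matrix \<sigma> *v ?A = system_rhs \<Omega> \<sigma> E J ?x ?y"
      by (simp add: vec_eq_iff forall_4 system_matrix_def system_rhs_def matrix_vector_mult_def
          sum_4 vector_4 cur1 cur2)
    moreover have "A11 \<alpha> + A22 \<alpha> \<le> vol_frac \<Omega> (P \<alpha>) * (c \<alpha>)\<^sup>2" for \<alpha>
      using phase_energy_le_threshold[OF L P E' assms(6)] by (simp add: A)
    ultimately show ?thesis
      unfolding compatible_region_def by (auto intro!: exI[of _ ?A] simp: vector_4)
  qed
  ultimately show ?thesis by blast
qed

end
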